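(* For every finite Coxeter system $(W,S)$, the $W$-permutahedron is in-your-face. That is, for any two vertices $v,v'$ of the $W$-permutahedron, every geodesic from $v$ to $v'$ in its $1$-skeleton stays in the minimal face of the $W$-permutahedron containing both $v$ and $v'$.
   Context: Polytopes and geodesics. Let $P$ be a finite convex polytope. For vertices $v,v'$ write $v\to v'$ if they are adjacent in the $1$-skeleton of $P$ or $v=v'$. A path from $v$ to $v'$ is a sequence $v=v_1\to v_2\to\cdots\to v_k=v'$; a geodesic from $v$ to $v'$ is a path of minimal length. $P$ is called in-your-face if for all vertices $v,v'$, any geodesic from $v$ to $v'$ stays in (i.e. all its vertices lie in) the minimal face containing both $v$ and $v'$. The $W$-permutahedron. Let $(W,S)$ be a finite Coxeter system acting on Euclidean space by its reflection representation. The $W$-permutahedron $\mathsf{Perm}(W)$ is the convex hull of the $W$-orbit of a generic point (a point on no reflecting hyperplane). Its vertices are in bijection with the elements $w\in W$. Its faces correspond to the cosets $wW_J$ for $w\in W$ and $J\subseteq S$, where $W_J$ is the standard parabolic subgroup generated by $J$; the vertices of the face $wW_J$ are the elements of that coset. In particular the edges join $w$ and $ws$ for $w\in W$, $s\in S$, and the facets are the cosets $wW_{\langle s\rangle}$, where $W_{\langle s\rangle}=W_{S\setminus\{s\}}$. *)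

theory Defs
  imports
    "HOL-Analysis.Analysis"
    "HOL-Algebra.Group_Action"
    "HOL-Algebra.Generated_Groups"
    "HOL-Algebra.Multiplicative_Group"
begin

section \<open>Coxeter systems\<close>

text \<open>\<open>ord\<close> of an element of infinite order is \<open>0\<close>, so the label \<open>\<infinity>\<close> of a Coxeter matrix
  is encoded by \<open>0\<close>.\<close>

definition coxeter_label :: "('w, 'm) monoid_scheme \<Rightarrow> 'w \<Rightarrow> 'w \<Rightarrow> nat" where
  "coxeter_label W s t = group.ord W (s \<otimes>\<^bsub>W\<^esub> t)"

definition word_prod :: "('w, 'm) monoid_scheme \<Rightarrow> 'w list \<Rightarrow> 'w" where
  "word_prod W ws = foldr (\<lambda>s w. s \<otimes>\<^bsub>W\<^esub> w) ws \<one>\<^bsub>W\<^esub>"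

text \<open>The congruence on words in \<open>S\<close> generated by the Coxeter relations
  \<open>(s t)^m(s,t) = 1\<close>. The case \<open>s = t\<close> gives \<open>s s = 1\<close>, because \<open>m(s,s) = 1\<close>; so inverse letters
  are not needed, and the quotient of the free monoid on \<open>S\<close> by this congruence is the group
  presented by these relations. A label \<open>0\<close> gives the trivial relation.\<close>

inductive coxeter_cong :: "('w, 'm) monoid_scheme \<Rightarrow> 'w set \<Rightarrow> 'w list \<Rightarrow> 'w list \<Rightarrow> bool"
  for W :: "('w, 'm) monoid_scheme" and S :: "'w set" where
  refl: "set u \<subseteq> S \<Longrightarrow> coxeter_cong W S u u"
| sym: "coxeter_cong W S u v \<Longrightarrow> coxeter_cong W S v u"
| trans: "coxeter_cong W S u v \<Longrightarrow> coxeter_cong W S v w \<Longrightarrow> coxeter_cong W S u w"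
| relator: "s \<in> S \<Longrightarrow> t \<in> S \<Longrightarrow> set u \<subseteq> S \<Longrightarrow> set v \<subseteq> S \<Longrightarrow>
    coxeter_cong W S (u @ concat (replicate (coxeter_label W s t) [s, t]) @ v) (u @ v)"

text \<open>\<open>S\<close> is a generating set of involutions, and the last conjunct says that the
  Coxeter relations are defining relations for \<open>W\<close>.\<close>

definition coxeter_system :: "('w, 'm) monoid_scheme \<Rightarrow> 'w set \<Rightarrow> bool" where
  "coxeter_system W S \<longleftrightarrow>
     group W \<and> S \<subseteq> carrier W \<and> generate W S = carrier W \<and>
     (\<forall>s\<in>S. group.ord W s = 2) \<and>
     (\<forall>u v. set u \<subseteq> S \<longrightarrow> set v \<subseteq> S \<longrightarrow> word_prod W u = word_prod W v \<longrightarrow> coxeter_cong W S u v)"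

section \<open>The reflection representation and the permutahedron\<close>

text \<open>The reflection representation of \<open>(W, S)\<close> on the Euclidean space with basis
  \<open>\<alpha> ` S\<close> of simple roots. This space is taken as the subspace \<open>span (\<alpha> ` S)\<close> of the ambient
  type, which also covers the trivial group with \<open>S = {}\<close>. For \<open>s = t\<close> the second line says
  that the simple roots are unit vectors.\<close>

definition reflection_representation ::
  "('w, 'm) monoid_scheme \<Rightarrow> 'w set \<Rightarrow> ('w \<Rightarrow> 'v::euclidean_space) \<Rightarrow> ('w \<Rightarrow> 'v \<Rightarrow> 'v) \<Rightarrow> bool" where
  "reflection_representation W S \<alpha> \<rho> \<longleftrightarrow>
     inj_on \<alpha> S \<and> independent (\<alpha> ` S) \<and>
     (\<forall>s\<in>S. \<forall>t\<in>S. \<alpha> s \<bullet> \<alpha> t = - cos (pi / real (coxeter_label W s t))) \<and>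
     group_action W (span (\<alpha> ` S)) \<rho> \<and>
     (\<forall>s\<in>S. \<forall>v\<in>span (\<alpha> ` S). \<rho> s v = v - (2 * (\<alpha> s \<bullet> v)) *\<^sub>R \<alpha> s)"

definition coxeter_reflections :: "('w, 'm) monoid_scheme \<Rightarrow> 'w set \<Rightarrow> 'w set" where
  "coxeter_reflections W S = {w \<otimes>\<^bsub>W\<^esub> s \<otimes>\<^bsub>W\<^esub> inv\<^bsub>W\<^esub> w | w s. w \<in> carrier W \<and> s \<in> S}"

definition reflecting_hyperplane ::
  "'w set \<Rightarrow> ('w \<Rightarrow> 'v::euclidean_space) \<Rightarrow> ('w \<Rightarrow> 'v \<Rightarrow> 'v) \<Rightarrow> 'w \<Rightarrow> 'v set" where
  "reflecting_hyperplane S \<alpha> \<rho> t = {v \<in> span (\<alpha> ` S). \<rho> t v = v}"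

definition generic_point ::
  "('w, 'm) monoid_scheme \<Rightarrow> 'w set \<Rightarrow> ('w \<Rightarrow> 'v::euclidean_space) \<Rightarrow> ('w \<Rightarrow> 'v \<Rightarrow> 'v) \<Rightarrow> 'v \<Rightarrow> bool" where
  "generic_point W S \<alpha> \<rho> x \<longleftrightarrow>
     x \<in> span (\<alpha> ` S) \<and> (\<forall>t\<in>coxeter_reflections W S. x \<notin> reflecting_hyperplane S \<alpha> \<rho> t)"

definition permutahedron ::
  "('w, 'm) monoid_scheme \<Rightarrow> ('w \<Rightarrow> 'v::euclidean_space \<Rightarrow> 'v) \<Rightarrow> 'v \<Rightarrow> 'v set" where
  "permutahedron W \<rho> x = convex hull (orbit W \<rho> x)"

section \<open>In-your-face polytopes\<close>

definition skeleton_step :: "'v::euclidean_space set \<Rightarrow> 'v \<Rightarrow> 'v \<Rightarrow> bool" where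
  "skeleton_step P v v' \<longleftrightarrow>
     v extreme_point_of P \<and> v' extreme_point_of P \<and>
     (v = v' \<or> (\<exists>e. e edge_of P \<and> v \<in> e \<and> v' \<in> e))"

text \<open>A path is the list of its vertices; \<open>successively\<close> is vacuous on singletons, hence the
  separate requirement that all entries be vertices.\<close>

definition skeleton_path :: "'v::euclidean_space set \<Rightarrow> 'v \<Rightarrow> 'v list \<Rightarrow> 'v \<Rightarrow> bool" where
  "skeleton_path P v p v' \<longleftrightarrow>
     p \<noteq> [] \<and> hd p = v \<and> last p = v' \<and>
     (\<forall>u\<in>set p. u extreme_point_of P) \<and> successively (skeleton_step P) p"

definition geodesic :: "'v::euclidean_space set \<Rightarrow> 'v \<Rightarrow> 'v list \<Rightarrow> 'v \<Rightarrow> bool" where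
  "geodesic P v p v' \<longleftrightarrow>
     skeleton_path P v p v' \<and> (\<forall>q. skeleton_path P v q v' \<longrightarrow> length p \<le> length q)"

definition minimal_face :: "'v::euclidean_space set \<Rightarrow> 'v set \<Rightarrow> 'v set" where
  "minimal_face P A = \<Inter>{F. F face_of P \<and> A \<subseteq> F}"

lemma minimal_face_face_of:
  assumes "convex P" "A \<subseteq> P"
  shows "minimal_face P A face_of P"
  unfolding minimal_face_def
  using assms by (intro face_of_Inter) (auto intro: face_of_refl)

definition in_your_face :: "'v::euclidean_space set \<Rightarrow> bool" where
  "in_your_face P \<longleftrightarrow>
     polytope P \<and>
     (\<forall>v v' p. v extreme_point_of P \<longrightarrow> v' extreme_point_of P \<longrightarrow> geodesic P v p v' \<longrightarrow>
        set p \<subseteq> minimal_face P {v, v'})"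

end

theory Submission
  imports Defs
begin

text \<open>Let \<open>b\<close> be a root and let \<open>v\<close>, \<open>v'\<close> be points of a face \<open>F\<close> lying on different sides of the
  mirror of \<open>b\<close>. Some point between \<open>v\<close> and \<open>v'\<close> also lies between their mirror images, so
  \<open>F\<close> contains these images. For an edge this says that crossing a mirror amounts to
  reflecting in it, and for a general face that an edge which leaves \<open>F\<close> through a mirror has all
  vertices of \<open>F\<close> on one side of that mirror. A path between two vertices of \<open>F\<close> that leaves \<open>F\<close>
  can therefore be folded along that mirror, which collapses the crossing edge: the path was
  not geodesic. That every edge crosses some mirror holds because an orbit meets every chamber at
  most once; this is again proved by folding, now applied to galleries.\<close>

section \<open>Reflections in unit vectors\<close>

definition mirror :: "'v::real_inner \<Rightarrow> 'v \<Rightarrow> 'v" where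
  "mirror b y = y - (2 * (b \<bullet> y)) *\<^sub>R b"

lemma linear_mirror: "linear (mirror b)"
  by (rule linearI) (simp_all add: mirror_def algebra_simps)

lemma mirror_uminus_root [simp]: "mirror (- b) = mirror b"
  by (rule ext) (simp add: mirror_def)

lemma inner_mirror_commute: "y \<bullet> mirror b z = mirror b y \<bullet> z"
  by (simp add: mirror_def algebra_simps inner_commute)

lemma inner_mirror_self: "u \<bullet> mirror b u = u \<bullet> u - 2 * (b \<bullet> u)\<^sup>2"
  by (simp add: mirror_def algebra_simps inner_commute power2_eq_square)

lemma mirror_root:
  assumes "norm b = 1"
  shows "mirror b b = - b"
  using assms by (simp add: mirror_def norm_eq_1 scaleR_2)

lemma mirror_mirror [simp]:
  assumes "norm b = 1"
  shows "mirror b (mirror b y) = y"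
  using assms by (simp add: mirror_def norm_eq_1 algebra_simps)

lemma inner_root_mirror [simp]:
  assumes "norm b = 1"
  shows "b \<bullet> mirror b y = - (b \<bullet> y)"
  using assms by (simp add: inner_mirror_commute mirror_root)

text \<open>The isometry \<open>mirror c\<close> carries the mirror of \<open>b\<close> to the
  mirror of \<open>mirror c b\<close>. This is what transports adjacency and galleries by
  reflections.\<close>

lemma mirror_conjugate:
  assumes "norm c = 1"
  shows "mirror (mirror c b) (mirror c y) = mirror c (mirror b y)"
proof -
  have "mirror c b \<bullet> mirror c y = b \<bullet> y"
    using assms by (simp add: inner_mirror_commute)
  then show ?thesis
    by (simp add: mirror_def[of "mirror c b"])
      (simp add: mirror_def[of b] linear_diff[OF linear_mirror] linear_scale[OF linear_mirror])
qed

lemma mirror_images_in_face: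
  fixes P :: "'v::euclidean_space set"
  assumes F: "F face_of P" and yF: "y \<in> F" "y' \<in> F"
    and mP: "mirror b y \<in> P" "mirror b y' \<in> P"
    and b: "norm b = 1" and sides: "b \<bullet> y > 0" "b \<bullet> y' < 0"
  shows "mirror b y \<in> F \<and> mirror b y' \<in> F"
proof -
  \<comment> \<open>At parameter \<open>t\<close> the segment from \<open>y\<close> to
    \<open>y'\<close> meets the mirror: the heights \<open>p\<close> and \<open>-q\<close> of its
    ends cancel with weights \<open>1 - t\<close> and \<open>t\<close>. The point \<open>?z\<close>
    is therefore its own mirror image.\<close>
  define p q t where "p = b \<bullet> y" and "q = - (b \<bullet> y')" and "t = p / (p + q)"
  have pq: "p > 0" "q > 0"
    using sides by (simp_all add: p_def q_def)
  then have t: "0 < t" "t < 1"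
    by (simp_all add: t_def)
  have "1 - t = q / (p + q)"
    using pq by (simp add: t_def diff_divide_eq_iff)
  then have tpq: "(1 - t) * p = t * q"
    by (simp add: t_def)
  let ?z = "(1 - t) *\<^sub>R y + t *\<^sub>R y'"
  have "(1 - t) *\<^sub>R mirror b y + t *\<^sub>R mirror b y' = ?z - (2 * ((1 - t) * p - t * q)) *\<^sub>R b"
    by (simp add: mirror_def p_def q_def algebra_simps)
  then have z: "(1 - t) *\<^sub>R mirror b y + t *\<^sub>R mirror b y' = ?z"
    using tpq by simp
  have "?z \<in> F"
    using face_of_imp_convex[OF F] yF t by (simp add: convex_alt)
  moreover have "mirror b y \<noteq> mirror b y'"
    using sides b by (metis less_asym mirror_mirror)
  then have "?z \<in> open_segment (mirror b y) (mirror b y')"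
    using z t by (auto simp: in_segment)
  ultimately show ?thesis
    using face_ofD[OF F] mP by blast
qed

section \<open>Folding along a mirror\<close>

text \<open>For a unit vector \<open>b\<close>, the retraction onto the half-space where
  \<open>b\<close> is nonnegative, as in the foldings of a Coxeter complex.\<close>

definition mirror_fold :: "'v::real_inner \<Rightarrow> 'v \<Rightarrow> 'v" where
  "mirror_fold b y = (if b \<bullet> y < 0 then mirror b y else y)"

text \<open>A step on one side is kept or reflected as a whole, and a crossing step collapses to a
  point. The relation \<open>R\<close> is left open to serve both galleries
  (\<open>adjacent\<close>) and edge paths (\<open>skeleton_step\<close>).\<close>

lemma mirror_fold_step:
  assumes "R y y'" "R (mirror b y) (mirror b y')" "b \<bullet> y \<noteq> 0" "b \<bullet> y' \<noteq> 0" "norm b = 1"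
    and "(b \<bullet> y) * (b \<bullet> y') < 0 \<Longrightarrow> y' = mirror b y"
  shows "mirror_fold b y = mirror_fold b y' \<or> R (mirror_fold b y) (mirror_fold b y')"
  using assms by (cases "b \<bullet> y < 0"; cases "b \<bullet> y' < 0")
    (auto simp: mirror_fold_def mult_less_0_iff)

lemma split_list_leaving:
  assumes "Q (hd p)" "p \<noteq> []" "\<not> (\<forall>y\<in>set p. Q y)"
  obtains xs a b ys where "p = xs @ a # b # ys" "Q a" "\<not> Q b"
proof -
  obtain as b ys where p: "p = as @ b # ys" "\<not> Q b" "\<forall>y\<in>set as. Q y"
    using split_list_first_prop[of p "\<lambda>y. \<not> Q y"] assms(3) by blast
  then have "as \<noteq> []"
    using assms(1) by auto
  then obtain xs a where "as = xs @ [a]"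
    by (metis append_butlast_last_id)
  then show ?thesis
    using p that by simp
qed

section \<open>Orbits of generic points\<close>

text \<open>\<open>R\<close> stands for the unit roots, of both signs, and \<open>X\<close> for the
  orbit. The group enters only through its reflections, and no simple roots are singled out.\<close>

locale generic_reflection_orbit =
  fixes R :: "'v::euclidean_space set" and X :: "'v set"
  assumes finite_orbit: "finite X"
    and norm_root: "b \<in> R \<Longrightarrow> norm b = 1"
    and mirror_root_in: "b \<in> R \<Longrightarrow> c \<in> R \<Longrightarrow> mirror b c \<in> R"
    and mirror_orbit: "b \<in> R \<Longrightarrow> y \<in> X \<Longrightarrow> mirror b y \<in> X"
    and generic: "b \<in> R \<Longrightarrow> y \<in> X \<Longrightarrow> b \<bullet> y \<noteq> 0"
    and connected_orbit: "y \<in> X \<Longrightarrow> z \<in> X \<Longrightarrow> (\<lambda>y z. \<exists>b\<in>R. z = mirror b y)\<^sup>*\<^sup>* y z"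
begin

section \<open>Galleries joining the points of the orbit\<close>

lemma uminus_root_in: "b \<in> R \<Longrightarrow> - b \<in> R"
  using mirror_root_in[of b b] by (simp add: mirror_root norm_root)

text \<open>The point \<open>z\<close> is the mirror image of \<open>y\<close> in a wall of the chamber of \<open>y\<close>.\<close>

definition adjacent :: "'v \<Rightarrow> 'v \<Rightarrow> bool" where
  "adjacent y z \<longleftrightarrow> y \<in> X \<and> (\<exists>b\<in>R. z = mirror b y) \<and>
     (\<forall>b\<in>R. (b \<bullet> y) * (b \<bullet> z) < 0 \<longrightarrow> z = mirror b y)"

lemma adjacent_in_orbit: "adjacent y z \<Longrightarrow> y \<in> X \<and> z \<in> X"
  unfolding adjacent_def using mirror_orbit by blast

lemma adjacent_mirror:
  assumes "adjacent y z" and c: "c \<in> R"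
  shows "adjacent (mirror c y) (mirror c z)"
  unfolding adjacent_def
proof (intro conjI ballI impI)
  show "mirror c y \<in> X"
    using assms adjacent_in_orbit mirror_orbit by blast
  obtain b where "b \<in> R" "z = mirror b y"
    using assms by (auto simp: adjacent_def)
  then show "\<exists>b\<in>R. mirror c z = mirror b (mirror c y)"
    using mirror_conjugate[of c b y] c norm_root mirror_root_in by metis
next
  fix b assume b: "b \<in> R" and "(b \<bullet> mirror c y) * (b \<bullet> mirror c z) < 0"
  then have "z = mirror (mirror c b) y"
    using assms mirror_root_in[OF c b] by (simp add: adjacent_def inner_mirror_commute)
  then show "mirror c z = mirror b (mirror c y)"
    using mirror_conjugate[of c "mirror c b" y] norm_root[OF c] by simp
qed

lemma gallery_mirror:
  assumes "adjacent\<^sup>*\<^sup>* y z" and c: "c \<in> R"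
  shows "adjacent\<^sup>*\<^sup>* (mirror c y) (mirror c z)"
  using assms(1)
proof (induction rule: rtranclp_induct)
  case (step z z')
  then show ?case
    using adjacent_mirror[OF _ c] by (meson rtranclp.rtrancl_into_rtrancl)
qed simp

text \<open>If the mirror of \<open>b\<close> is not a wall of the chamber of \<open>u\<close>, then \<open>b\<close> is a positive combination
  of two other roots that are positive on \<open>u\<close>. Since roots are unit vectors, one of these has a
  smaller value on \<open>u\<close> than \<open>b\<close>, and so has the image of \<open>b\<close> in its mirror.\<close>

lemma closer_root:
  assumes u: "u \<in> X" and b: "b \<in> R" and pos: "b \<bullet> u > 0" and nadj: "\<not> adjacent u (mirror b u)"
  obtains c where "c \<in> R" "\<bar>c \<bullet> u\<bar> < b \<bullet> u" "\<bar>mirror c b \<bullet> u\<bar> < b \<bullet> u"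
proof -
  obtain c' where c': "c' \<in> R" "(c' \<bullet> u) * (c' \<bullet> mirror b u) < 0" "mirror b u \<noteq> mirror c' u"
    using u b nadj by (auto simp: adjacent_def)
  define c where "c = (if c' \<bullet> u > 0 then c' else - c')"
  have c: "c \<in> R" "c \<bullet> u > 0" "c \<bullet> mirror b u < 0" "c \<noteq> b"
    using c' uminus_root_in[of c'] by (auto simp: c_def mult_less_0_iff)
  \<comment> \<open>A second root positive on \<open>u\<close>, with
    \<open>c + d = 2 * k * b\<close>. Once \<open>k < 1\<close> is known, the smaller of the values
    of \<open>c\<close> and \<open>d\<close> on \<open>u\<close> is at most
    \<open>k * (b \<bullet> u)\<close>, hence below \<open>b \<bullet> u\<close>.\<close>
  define d where "d = - mirror b c"
  define k where "k = b \<bullet> c"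
  have d: "d \<in> R" "d = (2 * k) *\<^sub>R b - c"
    using b c uminus_root_in mirror_root_in by (simp_all add: d_def) (simp add: k_def mirror_def)
  have bb: "b \<bullet> b = 1" and cc: "c \<bullet> c = 1"
    using norm_root b c by (auto simp: norm_eq_1[symmetric])
  have d_u: "d \<bullet> u = 2 * k * (b \<bullet> u) - c \<bullet> u"
    by (simp add: d inner_diff_left)
  have d_pos: "d \<bullet> u > 0"
    using c by (simp add: d_def inner_mirror_commute)
  then have k_pos: "k > 0"
    using d_u c pos by (smt (verit) mult_nonpos_nonneg mult_nonneg_nonneg)
  have "0 < (b - c) \<bullet> (b - c)"
    using c by simp
  then have k_less: "k < 1"
    by (simp add: inner_diff_left inner_diff_right bb cc k_def inner_commute)
  note result = that
  have closer: thesis if e: "e \<in> R" "e \<bullet> u > 0" "e \<bullet> u < b \<bullet> u" "b \<bullet> e = k" for e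
  proof (rule result[of e])
    have "mirror e b \<bullet> u = b \<bullet> u - 2 * (k * (e \<bullet> u))"
      using e by (simp add: mirror_def inner_diff_left inner_commute[of e b])
    moreover have "0 < k * (e \<bullet> u)" "k * (e \<bullet> u) < b \<bullet> u"
      using k_pos k_less e by (simp, smt (verit) mult_left_le_one_le)
    ultimately show "\<bar>mirror e b \<bullet> u\<bar> < b \<bullet> u"
      by linarith
  qed (use e in auto)
  have "k * (b \<bullet> u) < b \<bullet> u"
    using k_less pos by simp
  then consider "c \<bullet> u < b \<bullet> u" | "d \<bullet> u < b \<bullet> u"
    using d_u by linarith
  then show thesis
  proof cases
    case 1
    then show thesis using closer c k_def by blast
  next
    case 2
    have "b \<bullet> d = k"
      by (simp add: d inner_diff_right bb k_def)
    then show thesis using closer 2 d d_pos by blast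
  qed
qed

text \<open>Induction on the absolute value of \<open>b \<bullet> u\<close>, made well-founded by
  counting the orbit points \<open>z\<close> for which \<open>u \<bullet> z\<close> exceeds
  \<open>u \<bullet> mirror b u\<close>. If the mirror is not a wall, \<open>closer_root\<close>
  gives \<open>c\<close> and \<open>d = mirror c b\<close> with smaller values, and the reflection
  in \<open>b\<close> is the product of those in \<open>c\<close>, \<open>d\<close>,
  \<open>c\<close>.\<close>

lemma gallery_to_mirror_image:
  assumes "u \<in> X" "b \<in> R"
  shows "adjacent\<^sup>*\<^sup>* u (mirror b u)"
  using \<open>b \<in> R\<close>
proof (induction "card {z \<in> X. u \<bullet> mirror b u < u \<bullet> z}" arbitrary: b rule: less_induct)
  case less
  define b' where "b' = (if b \<bullet> u > 0 then b else - b)"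
  have b': "b' \<in> R" "b' \<bullet> u > 0" "mirror b' = mirror b"
    using less.prems uminus_root_in[of b] generic[of b u] assms by (auto simp: b'_def)
  have IH: "adjacent\<^sup>*\<^sup>* u (mirror c u)" if c: "c \<in> R" "\<bar>c \<bullet> u\<bar> < b' \<bullet> u" for c
  proof (rule less.hyps)
    have "(c \<bullet> u)\<^sup>2 < (b' \<bullet> u)\<^sup>2"
      using c by (metis abs_ge_zero power2_abs power_strict_mono zero_less_numeral)
    then have "u \<bullet> mirror b u < u \<bullet> mirror c u"
      using b' by (simp add: inner_mirror_self flip: b'(3))
    \<comment> \<open>The point \<open>mirror c u\<close> itself lies in the larger set
      only.\<close>
    then have "{z \<in> X. u \<bullet> mirror c u < u \<bullet> z} \<subset> {z \<in> X. u \<bullet> mirror b u < u \<bullet> z}"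
      using mirror_orbit[OF c(1) assms(1)] by force
    then show "card {z \<in> X. u \<bullet> mirror c u < u \<bullet> z} < card {z \<in> X. u \<bullet> mirror b u < u \<bullet> z}"
      using finite_orbit by (intro psubset_card_mono) auto
  qed (rule c)
  show ?case
  proof (cases "adjacent u (mirror b' u)")
    case True
    then show ?thesis using b' by auto
  next
    case False
    then obtain c where c: "c \<in> R" "\<bar>c \<bullet> u\<bar> < b' \<bullet> u" "\<bar>mirror c b' \<bullet> u\<bar> < b' \<bullet> u"
      using closer_root b' assms(1) by blast
    let ?d = "mirror c b'"
    have d: "?d \<in> R"
      using c b' mirror_root_in by blast
    have "adjacent\<^sup>*\<^sup>* (mirror c u) (mirror c (mirror c u))"
      using gallery_mirror[OF IH] c by blast
    then have "adjacent\<^sup>*\<^sup>* (mirror c u) u"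
      using norm_root c by simp
    also have "adjacent\<^sup>*\<^sup>* u (mirror ?d u)"
      using IH d c by blast
    also have "adjacent\<^sup>*\<^sup>* (mirror ?d u) (mirror ?d (mirror c u))"
      using gallery_mirror[OF IH] c d by blast
    \<comment> \<open>Reflecting the whole gallery in \<open>c\<close> moves its start to
      \<open>u\<close> and its end to the mirror image of \<open>u\<close> under
      \<open>b\<close>.\<close>
    finally have "adjacent\<^sup>*\<^sup>* (mirror c (mirror c u)) (mirror c (mirror ?d (mirror c u)))"
      using gallery_mirror c by blast
    then show ?thesis
      using norm_root[OF c(1)] b' by (simp add: mirror_conjugate)
  qed
qed

lemma gallery_connected:
  assumes "u \<in> X" "z \<in> X"
  shows "adjacent\<^sup>*\<^sup>* u z"
proof -
  have "adjacent\<^sup>*\<^sup>* u z \<and> z \<in> X"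
    using connected_orbit[OF assms]
  proof (induction rule: rtranclp_induct)
    case (step y z)
    then show ?case
      using gallery_to_mirror_image mirror_orbit by (blast intro: rtranclp_trans)
  qed (use assms in simp)
  then show ?thesis ..
qed

section \<open>Folding galleries: distinct orbit points lie in different chambers\<close>

lemma gallery_fold:
  assumes "(adjacent ^^ n) y z" and b: "b \<in> R"
  shows "\<exists>k\<le>n. (adjacent ^^ k) (mirror_fold b y) (mirror_fold b z)"
  using assms(1)
proof (induction n arbitrary: z)
  case 0
  then show ?case by auto
next
  case (Suc n)
  then obtain w where w: "(adjacent ^^ n) y w" "adjacent w z"
    by auto
  then obtain k where k: "k \<le> n" "(adjacent ^^ k) (mirror_fold b y) (mirror_fold b w)"
    using Suc.IH by blast
  \<comment> \<open>A step across the mirror of \<open>b\<close> collapses, so folding never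
    lengthens a gallery.\<close>
  have "mirror_fold b w = mirror_fold b z \<or> adjacent (mirror_fold b w) (mirror_fold b z)"
    using w(2) b adjacent_mirror[OF w(2) b] adjacent_in_orbit[OF w(2)] generic norm_root
    by (intro mirror_fold_step[of adjacent]) (simp_all add: adjacent_def)
  then show ?case
    using k by (metis le_Suc_eq not_less_eq_eq relpowp_Suc_I)
qed

text \<open>The first step reflects \<open>u\<close> to \<open>w\<close> in the mirror of some
  \<open>b\<close>. Folding the rest of the gallery along it returns \<open>w\<close> to
  \<open>u\<close> and fixes \<open>z\<close>, which lies on the side of \<open>u\<close>; this
  yields a shorter gallery from \<open>u\<close> to \<open>z\<close>.\<close>

lemma gallery_within_chamber:
  assumes "(adjacent ^^ n) u z" and same: "\<forall>b\<in>R. (b \<bullet> u) * (b \<bullet> z) \<ge> 0"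
  shows "u = z"
  using assms(1)
proof (induction n rule: less_induct)
  case (less n)
  show ?case
  proof (cases n)
    case 0
    then show ?thesis using less.prems by simp
  next
    case (Suc m)
    then obtain w where w: "adjacent u w" "(adjacent ^^ m) w z"
      using less.prems by (metis relpowp_Suc_D2)
    then obtain c where c: "c \<in> R" "w = mirror c u"
      by (auto simp: adjacent_def)
    define b where "b = (if c \<bullet> u > 0 then c else - c)"
    have uX: "u \<in> X"
      using w adjacent_in_orbit by blast
    then have b: "b \<in> R" "w = mirror b u" "b \<bullet> u > 0"
      using c uminus_root_in generic[of c u] by (auto simp: b_def)
    have "mirror_fold b w = u" "mirror_fold b z = z"
      using b norm_root[OF b(1)] same
      by (auto simp: mirror_fold_def zero_le_mult_iff not_less)
    then obtain k where "k \<le> m" "(adjacent ^^ k) u z"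
      using gallery_fold[OF w(2) b(1)] by auto
    then show ?thesis
      using less.IH[of k] Suc by simp
  qed
qed

text \<open>Supplies the mirror crossed by an edge that leaves a face.\<close>

lemma separating_root:
  assumes "u \<in> X" "z \<in> X" "u \<noteq> z"
  obtains b where "b \<in> R" "b \<bullet> u > 0" "b \<bullet> z < 0"
proof -
  obtain n where "(adjacent ^^ n) u z"
    using gallery_connected[OF assms(1,2)] by (metis rtranclp_imp_relpowp)
  then obtain b where b: "b \<in> R" "(b \<bullet> u) * (b \<bullet> z) < 0"
    using gallery_within_chamber assms(3) by (meson not_le)
  then show thesis
    using that[of b] that[of "- b"] uminus_root_in[of b] by (auto simp: mult_less_0_iff)
qed

section \<open>Edges and geodesics of the orbit polytope\<close>

abbreviation orbit_polytope :: "'v set" where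
  "orbit_polytope \<equiv> convex hull X"

lemma extreme_point_in_orbit: "u extreme_point_of orbit_polytope \<Longrightarrow> u \<in> X"
  using extreme_point_of_convex_hull by blast

lemma mirror_orbit_polytope:
  assumes b: "b \<in> R"
  shows "mirror b ` orbit_polytope = orbit_polytope"
proof -
  have "mirror b ` X = X"
    using mirror_orbit[OF b] mirror_mirror[OF norm_root[OF b]] by (auto simp: image_iff) metis
  then show ?thesis
    by (simp add: convex_hull_linear_image[OF linear_mirror])
qed

lemma inj_mirror: "b \<in> R \<Longrightarrow> inj (mirror b)"
  by (metis injI mirror_mirror norm_root)

lemma face_of_mirror:
  assumes "b \<in> R" "F face_of orbit_polytope"
  shows "mirror b ` F face_of orbit_polytope"
  using face_of_linear_image[OF linear_mirror inj_mirror] assms mirror_orbit_polytope by metis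

lemma extreme_point_mirror:
  assumes "b \<in> R" "u extreme_point_of orbit_polytope"
  shows "mirror b u extreme_point_of orbit_polytope"
  using face_of_mirror[of b "{u}"] assms by (simp add: face_of_singleton)

lemma skeleton_step_mirror:
  assumes b: "b \<in> R" and step: "skeleton_step orbit_polytope u z"
  shows "skeleton_step orbit_polytope (mirror b u) (mirror b z)"
proof -
  have "mirror b ` e edge_of orbit_polytope" if "e edge_of orbit_polytope" for e
    using that face_of_mirror[OF b] aff_dim_injective_linear_image[OF linear_mirror inj_mirror[OF b]]
    by (simp add: edge_of_def)
  then show ?thesis
    using step extreme_point_mirror[OF b] unfolding skeleton_step_def by blast
qed

text \<open>The mirror image of \<open>u\<close> is a vertex on the line of \<open>e\<close>. Three
  distinct extreme points cannot be collinear, and \<open>u\<close> differs from both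
  \<open>z\<close> and its image, so these two coincide.\<close>

lemma edge_crossing:
  assumes e: "e edge_of orbit_polytope" "u \<in> e" "z \<in> e"
    and ext: "u extreme_point_of orbit_polytope" "z extreme_point_of orbit_polytope"
    and b: "b \<in> R" and sides: "b \<bullet> u > 0" "b \<bullet> z < 0"
  shows "z = mirror b u"
proof -
  let ?w = "mirror b u"
  have ext_w: "?w extreme_point_of orbit_polytope"
    using extreme_point_mirror b ext by blast
  have face: "e face_of orbit_polytope" "aff_dim e = 1"
    using e by (auto simp: edge_of_def)
  have "?w \<in> e"
    using mirror_images_in_face[OF face(1) e(2,3) _ _ norm_root[OF b] sides]
      extreme_point_mirror[OF b] ext by (auto simp: extreme_point_of_def)
  moreover have "collinear e"
    using face by (simp add: collinear_aff_dim)
  ultimately have "collinear {u, z, ?w}"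
    using e by (auto intro: collinear_subset)
  moreover have no: "y \<notin> open_segment y1 y2"
    if "y extreme_point_of orbit_polytope" "y1 extreme_point_of orbit_polytope"
      "y2 extreme_point_of orbit_polytope" for y y1 y2
    using that by (auto simp: extreme_point_of_def)
  moreover have "b \<bullet> ?w < 0"
    using b norm_root sides by simp
  then have "u \<noteq> z" "u \<noteq> ?w"
    using sides by auto
  ultimately show ?thesis
    using ext ext_w unfolding collinear_between_cases between_mem_segment
    by (metis closed_segment_commute insertE open_segment_commute open_segment_def Diff_iff empty_iff)
qed

lemma skeleton_step_crossing:
  assumes "skeleton_step orbit_polytope u z" "b \<in> R" "(b \<bullet> u) * (b \<bullet> z) < 0"
  shows "z = mirror b u"
proof -
  have "u \<noteq> z"
    using assms(3) by (auto simp: mult_less_0_iff)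
  then obtain e where e: "e edge_of orbit_polytope" "u \<in> e" "z \<in> e"
    "u extreme_point_of orbit_polytope" "z extreme_point_of orbit_polytope"
    using assms(1) by (auto simp: skeleton_step_def)
  show ?thesis
    using edge_crossing[OF e assms(2)] edge_crossing[OF e uminus_root_in[OF assms(2)]] assms(3)
    by (auto simp: mult_less_0_iff)
qed

lemma extreme_point_fold:
  assumes "b \<in> R" "u extreme_point_of orbit_polytope"
  shows "mirror_fold b u extreme_point_of orbit_polytope"
  using extreme_point_mirror[OF assms] assms by (simp add: mirror_fold_def)

lemma skeleton_step_fold:
  assumes b: "b \<in> R" and step: "skeleton_step orbit_polytope u z"
  shows "skeleton_step orbit_polytope (mirror_fold b u) (mirror_fold b z)"
proof -
  have ext: "u extreme_point_of orbit_polytope" "z extreme_point_of orbit_polytope"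
    using step by (auto simp: skeleton_step_def)
  then have "mirror_fold b u = mirror_fold b z \<or>
      skeleton_step orbit_polytope (mirror_fold b u) (mirror_fold b z)"
    using b step skeleton_step_mirror skeleton_step_crossing generic extreme_point_in_orbit norm_root
    by (intro mirror_fold_step) auto
  \<comment> \<open>A collapsed edge still counts as a step, because \<open>skeleton_step\<close> is
    reflexive on vertices.\<close>
  then show ?thesis
    using extreme_point_fold[OF b] ext by (auto simp: skeleton_step_def)
qed

text \<open>The folded path has the same ends and repeats a vertex where \<open>u\<close> and
  \<open>z\<close> were; omitting one copy makes it shorter than the geodesic.\<close>

lemma geodesic_no_fold:
  assumes geo: "geodesic orbit_polytope v (xs @ u # z # ys) v'" and b: "b \<in> R"
    and ends: "b \<bullet> v > 0" "b \<bullet> v' > 0" and cross: "mirror_fold b u = mirror_fold b z"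
  shows False
proof -
  let ?p = "xs @ u # z # ys" and ?q = "map (mirror_fold b) (xs @ z # ys)"
  have path: "hd ?p = v" "last ?p = v'" "\<forall>y\<in>set ?p. y extreme_point_of orbit_polytope"
    "successively (skeleton_step orbit_polytope) ?p"
    using geo by (auto simp: geodesic_def skeleton_path_def)
  have "successively (skeleton_step orbit_polytope) (map (mirror_fold b) ?p)"
    unfolding successively_map
    by (rule successively_mono[OF path(4)]) (rule skeleton_step_fold[OF b])
  then have "successively (skeleton_step orbit_polytope) ?q"
    using cross by (auto simp: successively_append_iff successively_Cons)
  moreover have "\<forall>y\<in>set ?q. y extreme_point_of orbit_polytope"
    using path(3) extreme_point_fold[OF b] by auto
  \<comment> \<open>If \<open>xs\<close> is empty, the new head is the image of \<open>z\<close>,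
    which \<open>cross\<close> equates with that of \<open>u\<close>.\<close>
  moreover have "hd ?q = mirror_fold b (hd ?p)" "last ?q = mirror_fold b (last ?p)"
    using cross by (cases xs; auto simp: last_map)+
  then have "hd ?q = v" "last ?q = v'"
    using path ends by (auto simp: mirror_fold_def)
  ultimately have "skeleton_path orbit_polytope v ?q v'"
    by (simp add: skeleton_path_def)
  then have "length ?p \<le> length ?q"
    using geo by (auto simp: geodesic_def)
  then show False
    by simp
qed

lemma geodesic_in_face:
  assumes geo: "geodesic orbit_polytope v p v'" and F: "F face_of orbit_polytope" "v \<in> F" "v' \<in> F"
  shows "set p \<subseteq> F"
proof (rule ccontr)
  assume "\<not> set p \<subseteq> F"
  then have "\<not> (\<forall>y\<in>set p. y \<in> F)" "p \<noteq> []" "hd p \<in> F"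
    using geo F by (auto simp: geodesic_def skeleton_path_def)
  then obtain xs u z ys where p: "p = xs @ u # z # ys" "u \<in> F" "z \<notin> F"
    using split_list_leaving[of "\<lambda>y. y \<in> F" p] by blast
  have path: "\<forall>y\<in>set p. y extreme_point_of orbit_polytope" "v \<in> set p" "v' \<in> set p"
    using geo by (auto simp: geodesic_def skeleton_path_def)
  have step: "skeleton_step orbit_polytope u z"
    using geo p(1) by (simp add: geodesic_def skeleton_path_def successively_append_iff)
  have "set p \<subseteq> X"
    using path(1) extreme_point_in_orbit by blast
  then have X: "u \<in> X" "z \<in> X" "v \<in> X" "v' \<in> X"
    using path(2,3) p(1) \<open>set p \<subseteq> X\<close> by auto
  moreover have "u \<noteq> z"
    using p by auto
  ultimately obtain b where b: "b \<in> R" "b \<bullet> u > 0" "b \<bullet> z < 0"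
    using separating_root by blast
  then have z: "z = mirror b u"
    using skeleton_step_crossing[OF step] by (simp add: mult_less_0_iff)
  \<comment> \<open>An orbit point of \<open>F\<close> on the far side would, together with
    \<open>u\<close>, force the mirror image \<open>z\<close> of \<open>u\<close> into
    \<open>F\<close>.\<close>
  have pos: "b \<bullet> y > 0" if y: "y \<in> F" "y \<in> X" for y
  proof (rule ccontr)
    assume "\<not> b \<bullet> y > 0"
    then have "b \<bullet> y < 0"
      using generic[OF b(1) y(2)] by linarith
    then have "mirror b u \<in> F"
      using mirror_images_in_face[OF F(1) p(2) y(1) _ _ norm_root[OF b(1)] b(2)]
        mirror_orbit[OF b(1)] X y by (auto intro: hull_inc)
    then show False
      using z p by simp
  qed
  have "mirror_fold b u = mirror_fold b z"
    using b z norm_root[OF b(1)] by (simp add: mirror_fold_def)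
  then show False
    using geodesic_no_fold[of v xs u z ys v' b] geo p b pos F X by blast
qed

lemma in_your_face_orbit_polytope: "in_your_face orbit_polytope"
  unfolding in_your_face_def minimal_face_def
proof (intro conjI allI impI)
  show "polytope orbit_polytope"
    using finite_orbit by (auto simp: polytope_def)
next
  fix v v' p assume "geodesic orbit_polytope v p v'"
  then show "set p \<subseteq> \<Inter>{F. F face_of orbit_polytope \<and> {v, v'} \<subseteq> F}"
    using geodesic_in_face by (simp add: le_Inf_iff)
qed

end

section \<open>Coxeter groups in the reflection representation\<close>

theorem theorem3p2:
  fixes W :: "('w, 'm) monoid_scheme" and S :: "'w set"
    and \<alpha> :: "'w \<Rightarrow> 'v::euclidean_space" and \<rho> :: "'w \<Rightarrow> 'v \<Rightarrow> 'v" and x :: 'v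
  assumes "coxeter_system W S" and "finite (carrier W)"
    and "reflection_representation W S \<alpha> \<rho>"
    and "generic_point W S \<alpha> \<rho> x"
  shows "in_your_face (permutahedron W \<rho> x)"
proof -
  interpret group W
    using assms(1) by (simp add: coxeter_system_def)
  define V where "V = span (\<alpha> ` S)"
  interpret act: group_action W V \<rho>
    using assms(3) by (simp add: reflection_representation_def V_def)
  have S: "S \<subseteq> carrier W" "generate W S = carrier W" "\<And>s. s \<in> S \<Longrightarrow> ord s = 2"
    using assms(1) by (auto simp: coxeter_system_def)
  have simple: "\<rho> s y = mirror (\<alpha> s) y" if "s \<in> S" "y \<in> V" for s y
    using assms(3) that by (simp add: reflection_representation_def V_def mirror_def)
  have x: "x \<in> V" "\<And>t. t \<in> coxeter_reflections W S \<Longrightarrow> \<rho> t x \<noteq> x"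
    using assms(4) by (auto simp: generic_point_def reflecting_hyperplane_def V_def)
  have V_closed: "\<rho> g y \<in> V" if "g \<in> carrier W" "y \<in> V" for g y
    using act.element_image that by blast
  have comp: "\<rho> (g \<otimes>\<^bsub>W\<^esub> h) y = \<rho> g (\<rho> h y)" if "g \<in> carrier W" "h \<in> carrier W" "y \<in> V" for g h y
    using act.composition_rule that by blast
  have one_act: "\<rho> \<one>\<^bsub>W\<^esub> y = y" if "y \<in> V" for y
    using that by (simp flip: act.id_eq_one)
  have inv_act: "\<rho> g (\<rho> (inv\<^bsub>W\<^esub> g) y) = y" if "g \<in> carrier W" "y \<in> V" for g y
    using comp[of g "inv\<^bsub>W\<^esub> g" y] that by (simp add: one_act)
  have inv_act': "\<rho> (inv\<^bsub>W\<^esub> g) (\<rho> g y) = y" if "g \<in> carrier W" "y \<in> V" for g y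
    using comp[of "inv\<^bsub>W\<^esub> g" g y] that by (simp add: one_act)
  have norm_simple: "norm (\<alpha> s) = 1" if "s \<in> S" for s
  proof -
    \<comment> \<open>Thus the label of \<open>s\<close> with itself is 1, and
      \<open>- cos pi = 1\<close>.\<close>
    have "s [^]\<^bsub>W\<^esub> (2::nat) = \<one>\<^bsub>W\<^esub>"
      using that S by (metis pow_ord_eq_1 subsetD)
    then have "s \<otimes>\<^bsub>W\<^esub> s = \<one>\<^bsub>W\<^esub>"
      using that S by (auto simp: numeral_2_eq_2)
    then show ?thesis
      using assms(3) that by (simp add: reflection_representation_def coxeter_label_def norm_eq_1)
  qed
  let ?T = "coxeter_reflections W S"
  have T_carrier: "?T \<subseteq> carrier W"
    using S by (auto simp: coxeter_reflections_def)
  have T_conj: "g \<otimes>\<^bsub>W\<^esub> t \<otimes>\<^bsub>W\<^esub> inv\<^bsub>W\<^esub> g \<in> ?T" if t: "t \<in> ?T" and g: "g \<in> carrier W" for g t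
  proof -
    obtain w s where ws: "t = w \<otimes>\<^bsub>W\<^esub> s \<otimes>\<^bsub>W\<^esub> inv\<^bsub>W\<^esub> w" "w \<in> carrier W" "s \<in> S"
      using t by (auto simp: coxeter_reflections_def)
    then have "g \<otimes>\<^bsub>W\<^esub> t \<otimes>\<^bsub>W\<^esub> inv\<^bsub>W\<^esub> g = (g \<otimes>\<^bsub>W\<^esub> w) \<otimes>\<^bsub>W\<^esub> s \<otimes>\<^bsub>W\<^esub> inv\<^bsub>W\<^esub> (g \<otimes>\<^bsub>W\<^esub> w)"
      using g S by (simp add: inv_mult_group m_assoc subsetD)
    then show ?thesis
      using ws g by (auto simp: coxeter_reflections_def)
  qed
  have conj_act: "\<rho> (g \<otimes>\<^bsub>W\<^esub> t \<otimes>\<^bsub>W\<^esub> inv\<^bsub>W\<^esub> g) y = \<rho> g (\<rho> t (\<rho> (inv\<^bsub>W\<^esub> g) y))"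
    if "t \<in> carrier W" "g \<in> carrier W" "y \<in> V" for g t y
    using that V_closed by (simp add: comp)
  \<comment> \<open>Roots are described by the reflections they induce, so that closure under
    mirrors reduces to conjugation in \<open>W\<close>. The agreement is asked on \<open>V\<close>
    only, since \<rho> acts there.\<close>
  define R where "R = {b \<in> V. norm b = 1 \<and> (\<exists>t\<in>?T. \<forall>y\<in>V. \<rho> t y = mirror b y)}"
  let ?X = "orbit W \<rho> x"
  have simple_R: "\<alpha> s \<in> R" if "s \<in> S" for s
  proof -
    have "s \<in> ?T"
      using that S unfolding coxeter_reflections_def
      by clarsimp (metis inv_one one_closed l_one r_one subsetD)
    then show ?thesis
      using that norm_simple simple by (auto simp: R_def V_def span_base)
  qed
  have X_V: "?X \<subseteq> V"
    using V_closed x by (auto simp: orbit_def)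
  have X_closed: "\<rho> g y \<in> ?X" if g: "g \<in> carrier W" and y: "y \<in> ?X" for g y
  proof -
    obtain h where "h \<in> carrier W" "y = \<rho> h x"
      using y by (auto simp: orbit_def)
    then have "\<rho> g y = \<rho> (g \<otimes>\<^bsub>W\<^esub> h) x" "g \<otimes>\<^bsub>W\<^esub> h \<in> carrier W"
      using g x comp by simp_all
    then show ?thesis
      by (auto simp: orbit_def)
  qed
  interpret generic_reflection_orbit R ?X
  proof
    show "finite ?X"
      using assms(2) by (simp add: orbit_def setcompr_eq_image)
  next
    fix b assume "b \<in> R"
    then show "norm b = 1"
      by (simp add: R_def)
  next
    fix b c assume "b \<in> R" "c \<in> R"
    then obtain t t' where b: "b \<in> V" "norm b = 1" "t \<in> ?T" "\<And>y. y \<in> V \<Longrightarrow> \<rho> t y = mirror b y"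
      and c: "c \<in> V" "norm c = 1" "t' \<in> ?T" "\<And>y. y \<in> V \<Longrightarrow> \<rho> t' y = mirror c y"
      by (auto simp: R_def)
    have t: "t \<in> carrier W" "t' \<in> carrier W"
      using b c T_carrier by auto
    have "mirror b c \<bullet> mirror b c = 1"
      using b c by (simp add: inner_mirror_commute norm_eq_1)
    moreover have "mirror b c \<in> V"
      using V_closed[OF t(1) c(1)] b(4)[OF c(1)] by simp
    moreover have "\<rho> (t \<otimes>\<^bsub>W\<^esub> t' \<otimes>\<^bsub>W\<^esub> inv\<^bsub>W\<^esub> t) y = mirror (mirror b c) y" if y: "y \<in> V" for y
    proof -
      let ?z = "\<rho> (inv\<^bsub>W\<^esub> t) y"
      have z: "?z \<in> V" "\<rho> t' ?z \<in> V"
        using y t V_closed by auto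
      then have "\<rho> (t \<otimes>\<^bsub>W\<^esub> t' \<otimes>\<^bsub>W\<^esub> inv\<^bsub>W\<^esub> t) y = mirror b (mirror c ?z)"
        using conj_act[OF t(2,1) y] b(4) c(4) by metis
      also have "\<dots> = mirror (mirror b c) (\<rho> t ?z)"
        using mirror_conjugate b z by metis
      finally show ?thesis
        using inv_act t y by simp
    qed
    ultimately show "mirror b c \<in> R"
      using T_conj[OF c(3) t(1)] unfolding R_def by (auto simp: norm_eq_1)
  next
    fix b y assume "b \<in> R" and y: "y \<in> ?X"
    then obtain t where t: "t \<in> ?T" "\<And>y. y \<in> V \<Longrightarrow> \<rho> t y = mirror b y"
      by (auto simp: R_def)
    have yV: "y \<in> V" and tW: "t \<in> carrier W"
      using X_V y t T_carrier by auto
    show "mirror b y \<in> ?X"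
      using X_closed[OF tW y] t(2)[OF yV] by simp
    obtain h where h: "h \<in> carrier W" "y = \<rho> h x"
      using y by (auto simp: orbit_def)
    show "b \<bullet> y \<noteq> 0"
    proof
      assume "b \<bullet> y = 0"
      then have "\<rho> t y = y"
        using t yV by (simp add: mirror_def)
      \<comment> \<open>Genericity is assumed at \<open>x\<close> only: a reflection fixing
        \<open>y\<close> is conjugated by \<open>h\<close> into one fixing \<open>x\<close>.\<close>
      then have "\<rho> (inv\<^bsub>W\<^esub> h \<otimes>\<^bsub>W\<^esub> t \<otimes>\<^bsub>W\<^esub> inv\<^bsub>W\<^esub> (inv\<^bsub>W\<^esub> h)) x = x"
        using conj_act[OF tW inv_closed[OF h(1)] x(1)] h inv_act' x by simp
      then show False
        using x(2) T_conj t h by blast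
    qed
  next
    fix y z assume y: "y \<in> ?X" and z: "z \<in> ?X"
    let ?r = "\<lambda>y z. \<exists>b\<in>R. z = mirror b y"
    \<comment> \<open>The claim covers all \<open>y\<close> because the product case applies it to
      \<open>g\<close> at the point \<open>\<rho> h y\<close>.\<close>
    have reach: "\<forall>y\<in>?X. ?r\<^sup>*\<^sup>* y (\<rho> g y)" if "g \<in> generate W S" for g
      using that
    proof (induction rule: generate.induct)
      case one
      then show ?case
        using one_act X_V by auto
    next
      case (incl s)
      then show ?case
        using simple_R simple X_V by (blast intro: r_into_rtranclp)
    next
      case (inv s)
      show ?case
      proof
        fix y assume "y \<in> ?X"
        then have "y \<in> V" "\<rho> (inv\<^bsub>W\<^esub> s) y \<in> V" "\<rho> s (\<rho> (inv\<^bsub>W\<^esub> s) y) = y"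
          using inv S X_V V_closed inv_act by (auto simp: subset_iff)
        then have "\<rho> (inv\<^bsub>W\<^esub> s) y = mirror (\<alpha> s) y"
          using inv simple norm_simple by (metis mirror_mirror)
        then show "?r\<^sup>*\<^sup>* y (\<rho> (inv\<^bsub>W\<^esub> s) y)"
          using simple_R inv by blast
      qed
    next
      case (eng g h)
      then have gh: "g \<in> carrier W" "h \<in> carrier W"
        using S by auto
      show ?case
      proof
        fix y assume y: "y \<in> ?X"
        then have "?r\<^sup>*\<^sup>* y (\<rho> h y)" "?r\<^sup>*\<^sup>* (\<rho> h y) (\<rho> g (\<rho> h y))"
          using eng.IH X_closed[OF gh(2)] by auto
        then show "?r\<^sup>*\<^sup>* y (\<rho> (g \<otimes>\<^bsub>W\<^esub> h) y)"
          using comp[OF gh] X_V y by (metis (lifting) rtranclp_trans subsetD)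
      qed
    qed
    obtain g h where gh: "g \<in> carrier W" "y = \<rho> g x" "h \<in> carrier W" "z = \<rho> h x"
      using y z by (auto simp: orbit_def)
    then have "z = \<rho> (h \<otimes>\<^bsub>W\<^esub> inv\<^bsub>W\<^esub> g) y"
      using comp V_closed inv_act' x by simp
    then show "?r\<^sup>*\<^sup>* y z"
      using reach[of "h \<otimes>\<^bsub>W\<^esub> inv\<^bsub>W\<^esub> g"] gh S(2) y by auto
  qed
  show ?thesis
    using in_your_face_orbit_polytope by (simp add: permutahedron_def)
qed

end
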